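(* If $(i,j)$ and $(i',j')$ are both winning bites of the same bar and $i<i'$, then $j>j'$. Moreover no winning bite of an $a\times b$ bar with $a\ge2$, $ab\ge2$ lies in row $1$; by the transposition symmetry of the game, none lies in column $1$. Consequently the winning bites form a strict antichain in the product order, there is at most one in each row and each column, and at most $\min(a-1,b-1)$ in total.
   Context: Chomp on the $a\times b$ bar: the board consists of the cells $(r,c)$ with $1\le r\le a$, $1\le c\le b$ (rows indexed downward). Two players alternate. A move (bite) at a remaining cell $(i,j)$ removes every remaining cell $(r,c)$ with $r\ge i$ and $c\ge j$. The player forced to take the poisoned cell $(1,1)$ loses. A position is a $P$-position if the player to move loses under optimal play. A winning bite of the bar is an opening move (a bite of the full bar) that leaves a $P$-position for the opponent. In the paper, "strict antichain in the product order" refers to the first assertion: of two distinct winning bites, the one in the lower-numbered row lies in the higher-numbered column. The transposition symmetry is the fact that transposing the board preserves $P$-positions and puts the winning bites of the $a\times b$ bar in bijection with those of the $b\times a$ bar.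
   Formalization: The column 1 claim is stated for b≥2 and the bound min(a-1,b-1) for a,b≥2: for b=1, a≥2 the bite (2,1) leaves only the poisoned cell, so it is a winning bite in column 1 and exceeds the bound 0; likewise (1,2) exceeds the bound when a=1, b≥2. *)

theory Defs
  imports Main
begin

text \<open>A cell is a pair (row, column), counted from 1; a position is the set of remaining cells.\<close>

type_synonym cell = "nat \<times> nat"

definition bar :: "nat \<Rightarrow> nat \<Rightarrow> cell set" where
  "bar a b = {1..a} \<times> {1..b}"

definition bite :: "cell \<Rightarrow> cell set \<Rightarrow> cell set" where
  "bite = (\<lambda>(i, j) X. {(r, c) \<in> X. \<not> (i \<le> r \<and> j \<le> c)})"

text \<open>
  The predicates say that the player to move wins, respectively loses, under optimal play.
  In every position reachable from a bar the only bite that leaves the empty set is the one at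
  the poisoned cell (1,1). The player to move at the empty set is thus the opponent of the one
  who has just taken the poison, and so has won; this is the opposite of the normal-play
  convention, and in particular the empty set is not a P-position.
\<close>

inductive N_position :: "cell set \<Rightarrow> bool" and P_position :: "cell set \<Rightarrow> bool" where
  poison_taken: "N_position {}"
| winning_move: "x \<in> X \<Longrightarrow> P_position (bite x X) \<Longrightarrow> N_position X"
| all_moves_lose: "X \<noteq> {} \<Longrightarrow> (\<And>x. x \<in> X \<Longrightarrow> N_position (bite x X)) \<Longrightarrow> P_position X"

definition winning_bites :: "nat \<Rightarrow> nat \<Rightarrow> cell set" where
  "winning_bites a b = {x \<in> bar a b. P_position (bite x (bar a b))}"

text \<open>
  Equivalently, distinct elements are incomparable in the componentwise order \<open>\<le>\<close>: of two
  elements, the one in the lower-numbered row lies in the higher-numbered column.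
\<close>

definition strict_antichain :: "cell set \<Rightarrow> bool" where
  "strict_antichain S \<longleftrightarrow>
    (\<forall>(i, j) \<in> S. \<forall>(i', j') \<in> S. (i, j) \<noteq> (i', j') \<longrightarrow> (i < i' \<and> j > j') \<or> (i' < i \<and> j' > j))"

end

theory Submission
  imports Defs
begin

text \<open>
  Everything rests on one remark: if \<open>x \<le> y\<close> componentwise, then a bite at \<open>x\<close> erases the effect of
  an earlier bite at \<open>y\<close> (\<open>bite_absorb\<close>). If two distinct winning bites \<open>x \<le> y\<close> were comparable, the
  opponent could answer \<open>y\<close> with \<open>x\<close>, which is still available, and reach a \<open>P\<close>-position from a
  \<open>P\<close>-position; this is impossible because no position is both \<open>P\<close> and \<open>N\<close>. Hence winning bites are
  pairwise incomparable (\<open>winning_bites_incomparable\<close>).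

  The same remark gives strategy stealing: on a bar with at least two cells, any good answer to a
  bite at the far corner could have been played at once, so such a bar is not a \<open>P\<close>-position
  (\<open>bar_not_P\<close>). A bite in row 1 leaves either nothing or a smaller bar with the same number of
  rows; with at least two rows this is never a \<open>P\<close>-position. Transposition carries this over to
  column 1 of a bar with at least two columns. If both sides are at least 2, the bound on the number
  of winning bites follows, since both projections are injective on the winning bites and avoid the
  value 1.
\<close>

lemma not_P_and_N: "N_position X \<Longrightarrow> \<not> P_position X"
  and not_N_and_P: "P_position X \<Longrightarrow> \<not> N_position X"
proof (induction rule: N_position_P_position.inducts)
  case poison_taken
  then show ?case by (auto elim: P_position.cases)
next
  case (winning_move x X)
  then show ?case by (auto elim: P_position.cases)
next
  case (all_moves_lose X)
  then show ?case by (auto elim: N_position.cases)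
qed

lemma bite_absorb:
  assumes "i \<le> i'" and "j \<le> j'"
  shows "bite (i, j) (bite (i', j') X) = bite (i, j) X"
  using assms by (auto simp: bite_def)

lemma winning_bites_incomparable:
  assumes "(i, j) \<in> winning_bites a b" and "(i', j') \<in> winning_bites a b"
    and "i \<le> i'" and "j \<le> j'"
  shows "(i, j) = (i', j')"
proof (rule ccontr)
  assume "(i, j) \<noteq> (i', j')"
  then have "(i, j) \<in> bite (i', j') (bar a b)"
    using assms by (auto simp: winning_bites_def bite_def)
  moreover have "P_position (bite (i, j) (bite (i', j') (bar a b)))"
    using assms by (simp add: bite_absorb winning_bites_def)
  ultimately have "N_position (bite (i', j') (bar a b))"
    by (rule winning_move)
  then show False
    using assms not_P_and_N by (auto simp: winning_bites_def)
qed

lemma winning_bites_decreasing: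
  assumes "(i, j) \<in> winning_bites a b" and "(i', j') \<in> winning_bites a b" and "i < i'"
  shows "j' < j"
  using winning_bites_incomparable[OF assms(1,2)] assms(3) by force

lemma bar_not_P:
  assumes "a * b \<ge> 2"
  shows "\<not> P_position (bar a b)"
proof
  assume P: "P_position (bar a b)"
  have pos: "a \<ge> 1" "b \<ge> 1"
    using assms by (auto simp: Suc_le_eq intro!: Nat.gr0I)
  then have corner: "(a, b) \<in> bar a b"
    by (simp add: bar_def)
  with P have "N_position (bite (a, b) (bar a b))"
    by (auto elim: P_position.cases)
  moreover have "bite (a, b) (bar a b) \<noteq> {}"
  proof -
    have "(a, b) \<noteq> (1, 1)" using assms by auto
    then have "(1, 1) \<in> bite (a, b) (bar a b)"
      using pos by (auto simp: bite_def bar_def)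
    then show ?thesis by blast
  qed
  ultimately obtain y where "y \<in> bite (a, b) (bar a b)"
    and "P_position (bite y (bite (a, b) (bar a b)))"
    by (blast elim: N_position.cases)
  then obtain i j where y: "(i, j) \<in> bite (a, b) (bar a b)"
    and "P_position (bite (i, j) (bite (a, b) (bar a b)))"
    by (cases y) blast
  moreover have "(i, j) \<in> bar a b" "i \<le> a" "j \<le> b"
    using y by (auto simp: bite_def bar_def)
  ultimately have "N_position (bar a b)"
    using winning_move by (metis bite_absorb)
  with P show False
    using not_N_and_P by blast
qed

lemma no_winning_bite_row_1:
  assumes "a \<ge> 2"
  shows "(1, j) \<notin> winning_bites a b"
proof
  assume win: "(1, j) \<in> winning_bites a b"
  then have "j \<le> b" "j \<ge> 1" by (auto simp: winning_bites_def bar_def)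
  then have "bite (1, j) (bar a b) = bar a (j - 1)"
    by (auto simp: bite_def bar_def)
  with win have P: "P_position (bar a (j - 1))"
    by (simp add: winning_bites_def)
  show False
  proof (cases "j = 1")
    case True
    \<comment> \<open>the poison was eaten; the opponent has already won\<close>
    then have "bar a (j - 1) = {}" by (auto simp: bar_def)
    then show False using P by (auto elim: P_position.cases)
  next
    case False
    then have "a * (j - 1) \<ge> 2"
      using assms \<open>j \<ge> 1\<close> mult_le_mono[of 2 a 1 "j - 1"] by auto
    then show False using P bar_not_P by blast
  qed
qed

lemma bite_swap: "bite (prod.swap x) (prod.swap ` X) = prod.swap ` bite x X"
  by (cases x) (force simp: bite_def)

lemma N_position_swap: "N_position X \<Longrightarrow> N_position (prod.swap ` X)"
  and P_position_swap: "P_position X \<Longrightarrow> P_position (prod.swap ` X)"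
proof (induction rule: N_position_P_position.inducts)
  case poison_taken
  then show ?case by (simp add: N_position_P_position.poison_taken)
next
  case (winning_move x X)
  then show ?case
    by (metis N_position_P_position.winning_move bite_swap imageI)
next
  case (all_moves_lose X)
  show ?case
  proof (rule N_position_P_position.all_moves_lose)
    show "prod.swap ` X \<noteq> {}" using all_moves_lose by simp
    fix y assume "y \<in> prod.swap ` X"
    then obtain x where "x \<in> X" "y = prod.swap x" by blast
    then show "N_position (bite y (prod.swap ` X))"
      using all_moves_lose by (simp add: bite_swap)
  qed
qed

lemma P_position_swap_iff: "P_position (prod.swap ` X) \<longleftrightarrow> P_position X"
proof
  assume "P_position (prod.swap ` X)"
  then have "P_position (prod.swap ` (prod.swap ` X))" by (rule P_position_swap)
  then show "P_position X" by (simp add: image_image)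
qed (rule P_position_swap)

lemma swap_in_winning_bites_iff:
  "prod.swap x \<in> winning_bites b a \<longleftrightarrow> x \<in> winning_bites a b"
proof -
  have "bar b a = prod.swap ` bar a b"
    by (auto simp: bar_def product_swap)
  then show ?thesis
    by (auto simp: winning_bites_def bite_swap P_position_swap_iff inj_image_mem_iff)
qed

lemma bij_betw_swap_winning_bites:
  "bij_betw prod.swap (winning_bites a b) (winning_bites b a)"
  by (rule bij_betw_byWitness[where f' = prod.swap])
    (simp_all add: image_subset_iff swap_in_winning_bites_iff)

lemma no_winning_bite_column_1:
  assumes "b \<ge> 2"
  shows "(i, 1) \<notin> winning_bites a b"
  using no_winning_bite_row_1[OF assms, of i a] swap_in_winning_bites_iff[of "(i, 1)" b a]
  by simp

lemma winning_bites_row_unique: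
  assumes "(i, j) \<in> winning_bites a b" and "(i, j') \<in> winning_bites a b"
  shows "j = j'"
  using winning_bites_incomparable[OF assms] winning_bites_incomparable[OF assms(2,1)]
  by (cases "j \<le> j'") auto

lemma winning_bites_column_unique:
  assumes "(i, j) \<in> winning_bites a b" and "(i', j) \<in> winning_bites a b"
  shows "i = i'"
  using winning_bites_decreasing[OF assms] winning_bites_decreasing[OF assms(2,1)]
  by (cases i i' rule: linorder_cases) auto

lemma strict_antichain_winning_bites: "strict_antichain (winning_bites a b)"
proof -
  have "(i < i' \<and> j' < j) \<or> (i' < i \<and> j < j')"
    if wins: "(i, j) \<in> winning_bites a b" "(i', j') \<in> winning_bites a b"
      and "(i, j) \<noteq> (i', j')" for i j i' j'
    using that winning_bites_decreasing[OF wins] winning_bites_decreasing[OF wins(2,1)]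
      winning_bites_row_unique[OF wins(1)]
    by (cases i i' rule: linorder_cases) blast+
  then show ?thesis
    unfolding strict_antichain_def by blast
qed

text \<open>
  Distinct winning bites lie in distinct rows, and the first row is excluded. The bound by columns
  follows by applying this lemma to the transposed bar.
\<close>

lemma card_winning_bites_le:
  assumes "a \<ge> 2"
  shows "card (winning_bites a b) \<le> a - 1"
proof -
  have "inj_on fst (winning_bites a b)"
    by (auto simp: inj_on_def dest: winning_bites_row_unique)
  moreover have "fst ` winning_bites a b \<subseteq> {2..a}"
  proof
    fix i assume "i \<in> fst ` winning_bites a b"
    then obtain j where win: "(i, j) \<in> winning_bites a b" by auto
    moreover from win have "i \<noteq> 1" using no_winning_bite_row_1[OF assms] by metis
    ultimately show "i \<in> {2..a}" by (auto simp: winning_bites_def bar_def)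
  qed
  ultimately have "card (winning_bites a b) \<le> card {2..a}"
    by (intro card_inj_on_le) auto
  then show ?thesis by simp
qed

theorem theorem4p1:
  fixes a b :: nat
  assumes "a \<ge> 1" and "b \<ge> 1"
  shows
    "(\<forall>i j i' j'. (i, j) \<in> winning_bites a b \<and> (i', j') \<in> winning_bites a b \<and> i < i' \<longrightarrow> j > j')
   \<and> (a \<ge> 2 \<and> a * b \<ge> 2 \<longrightarrow> (\<forall>j. (1, j) \<notin> winning_bites a b))
   \<and> (\<forall>X. P_position (prod.swap ` X) \<longleftrightarrow> P_position X)
   \<and> bij_betw prod.swap (winning_bites a b) (winning_bites b a)
   \<and> (b \<ge> 2 \<and> a * b \<ge> 2 \<longrightarrow> (\<forall>i. (i, 1) \<notin> winning_bites a b))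
   \<and> strict_antichain (winning_bites a b)
   \<and> (\<forall>i j j'. (i, j) \<in> winning_bites a b \<and> (i, j') \<in> winning_bites a b \<longrightarrow> j = j')
   \<and> (\<forall>i i' j. (i, j) \<in> winning_bites a b \<and> (i', j) \<in> winning_bites a b \<longrightarrow> i = i')
   \<and> (a \<ge> 2 \<and> b \<ge> 2 \<longrightarrow> card (winning_bites a b) \<le> min (a - 1) (b - 1))"
proof (intro conjI)
  show "a \<ge> 2 \<and> b \<ge> 2 \<longrightarrow> card (winning_bites a b) \<le> min (a - 1) (b - 1)"
    using card_winning_bites_le[of a b] card_winning_bites_le[of b a]
      bij_betw_same_card[OF bij_betw_swap_winning_bites, of a b] by simp
  show "bij_betw prod.swap (winning_bites a b) (winning_bites b a)"
    by (rule bij_betw_swap_winning_bites)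
  show "strict_antichain (winning_bites a b)"
    by (rule strict_antichain_winning_bites)
  show "\<forall>X. P_position (prod.swap ` X) \<longleftrightarrow> P_position X"
    by (simp add: P_position_swap_iff)
  show "\<forall>i j i' j'. (i, j) \<in> winning_bites a b \<and> (i', j') \<in> winning_bites a b \<and> i < i' \<longrightarrow> j > j'"
    using winning_bites_decreasing by blast
  show "a \<ge> 2 \<and> a * b \<ge> 2 \<longrightarrow> (\<forall>j. (1, j) \<notin> winning_bites a b)"
    using no_winning_bite_row_1 by blast
  show "b \<ge> 2 \<and> a * b \<ge> 2 \<longrightarrow> (\<forall>i. (i, 1) \<notin> winning_bites a b)"
    using no_winning_bite_column_1 by blast
  show "\<forall>i j j'. (i, j) \<in> winning_bites a b \<and> (i, j') \<in> winning_bites a b \<longrightarrow> j = j'"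
    using winning_bites_row_unique by blast
  show "\<forall>i i' j. (i, j) \<in> winning_bites a b \<and> (i', j) \<in> winning_bites a b \<longrightarrow> i = i'"
    using winning_bites_column_unique by blast
qed

end
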